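(* Let $m,n\ge 2$ with $m=2k$ even, and let $\mathcal{B}\in S_{m,n}$ have associated homogeneous polynomial $\sum_{|\alpha|=2k}b_\alpha\mathbf{x}^\alpha$. For a real homogeneous polynomial $p(\mathbf{x})=\sum_{|\beta|=k}c_\beta\mathbf{x}^\beta$ of degree $k$, let $p^2$ denote the symmetric tensor representing $p(\mathbf{x})^2$, with entries $(p^2)_\alpha=\sum_{\beta+\gamma=\alpha}c_\beta c_\gamma$ for $|\alpha|=2k$, and set $\mathcal{B}(p^2)=(p^2)\bullet\mathcal{B}=\sum_{|\alpha|=2k}b_\alpha(p^2)_\alpha$. Then $$\mathcal{B}\in SOS_{m,n}^*\iff \mathcal{B}(p^2)\ge 0\quad\text{for all } p\in\mathbb{R}[x_1,\dots,x_n]_k .$$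
   Context: $S_{m,n}$ is the space of real symmetric tensors of order $m$ and dimension $n$; each $\mathcal{A}\in S_{m,n}$ is identified with its homogeneous polynomial of degree $m$, written in the unnormalized monomial basis (no multinomial coefficients) as $\mathcal{A}(\mathbf{x})=\sum_{|\alpha|=m}a_\alpha\mathbf{x}^\alpha$, where $\alpha\in\mathbb{N}^n$, $|\alpha|=\alpha_1+\cdots+\alpha_n$, $\mathbf{x}^\alpha=x_1^{\alpha_1}\cdots x_n^{\alpha_n}$. The inner product used here is $\mathcal{A}\bullet\mathcal{B}=\sum_{|\alpha|=m}a_\alpha b_\alpha$. $\mathbb{R}[x_1,\dots,x_n]_k$ is the space of real homogeneous polynomials of degree $k$. $SOS_{m,n}$ ($m=2k$) is the cone of tensors whose polynomial is a finite sum of squares of elements of $\mathbb{R}[x_1,\dots,x_n]_k$. Its dual cone is $SOS_{m,n}^*=\{\mathcal{B}\in S_{m,n}:\mathcal{A}\bullet\mathcal{B}\ge 0\ \forall\mathcal{A}\in SOS_{m,n}\}$, with respect to this inner product. *)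

theory Defs
  imports Complex_Main "HOL-Library.Multiset" "HOL-Library.Poly_Mapping"
begin

text \<open>
  Real polynomials in the variables \<open>x\<^sub>0, x\<^sub>1, \<dots>\<close> are elements of the monoid algebra
  \<open>(nat \<Rightarrow>\<^sub>0 nat) \<Rightarrow>\<^sub>0 real\<close>: a multi-index \<open>\<alpha>\<close> is a finitely supported function
  \<open>nat \<Rightarrow>\<^sub>0 nat\<close>, \<open>lookup f \<alpha>\<close> is the coefficient of \<open>x\<^sup>\<alpha>\<close>, and \<open>*\<close> is the Cauchy product.
  Polynomials in \<open>n\<close> variables use the indices \<open>0, \<dots>, n - 1\<close>.
\<close>

type_synonym mpoly = "(nat \<Rightarrow>\<^sub>0 nat) \<Rightarrow>\<^sub>0 real"

definition multi_indices :: "nat \<Rightarrow> nat \<Rightarrow> (nat \<Rightarrow>\<^sub>0 nat) set" where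
  "multi_indices n d = {\<alpha>. Poly_Mapping.keys \<alpha> \<subseteq> {..<n} \<and> (\<Sum>i<n. Poly_Mapping.lookup \<alpha> i) = d}"

definition hom_polys :: "nat \<Rightarrow> nat \<Rightarrow> mpoly set" where
  "hom_polys n d = {f. Poly_Mapping.keys f \<subseteq> multi_indices n d}"

text \<open>
  A tensor of order \<open>m\<close> and dimension \<open>n\<close> assigns a real entry to every index tuple
  \<open>(i\<^sub>1, \<dots>, i\<^sub>m)\<close>, represented as a list. Entries at lists that are not index tuples are
  fixed to be \<open>0\<close>, so that equality of tensors is equality of functions.
\<close>

definition index_tuples :: "nat \<Rightarrow> nat \<Rightarrow> nat list set" where
  "index_tuples m n = {is. set is \<subseteq> {..<n} \<and> length is = m}"

definition sym_tensors :: "nat \<Rightarrow> nat \<Rightarrow> (nat list \<Rightarrow> real) set" where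
  "sym_tensors m n =
     {A. (\<forall>is. is \<notin> index_tuples m n \<longrightarrow> A is = 0) \<and>
         (\<forall>is js. mset is = mset js \<longrightarrow> A is = A js)}"

text \<open>The exponent of the monomial \<open>x\<^bsub>i\<^sub>1\<^esub> \<cdots> x\<^bsub>i\<^sub>m\<^esub>\<close>.\<close>

definition tuple_exponent :: "nat list \<Rightarrow> (nat \<Rightarrow>\<^sub>0 nat)" where
  "tuple_exponent is = (\<Sum>i\<leftarrow>is. Poly_Mapping.single i 1)"

text \<open>
  The associated polynomial is the sum of \<open>A\<^bsub>i\<^sub>1 \<dots> i\<^sub>m\<^esub> x\<^bsub>i\<^sub>1\<^esub> \<cdots> x\<^bsub>i\<^sub>m\<^esub>\<close> over all tuples, so its coefficient
  at \<open>x\<^sup>\<alpha>\<close> is the entry of \<open>A\<close> times the number of tuples of exponent \<open>\<alpha>\<close>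
  (a multinomial coefficient).
\<close>

definition tensor_poly :: "nat \<Rightarrow> nat \<Rightarrow> (nat list \<Rightarrow> real) \<Rightarrow> mpoly" where
  "tensor_poly m n A = (\<Sum>is\<in>index_tuples m n. Poly_Mapping.single (tuple_exponent is) (A is))"

definition tensor_coeff :: "nat \<Rightarrow> nat \<Rightarrow> (nat list \<Rightarrow> real) \<Rightarrow> (nat \<Rightarrow>\<^sub>0 nat) \<Rightarrow> real" where
  "tensor_coeff m n A \<alpha> = Poly_Mapping.lookup (tensor_poly m n A) \<alpha>"

text \<open>The inverse of \<open>tensor_poly\<close>; see \<open>tensor_poly_of_poly\<close> and \<open>tensor_of_tensor_poly\<close> below.\<close>

definition tensor_of_poly :: "nat \<Rightarrow> nat \<Rightarrow> mpoly \<Rightarrow> nat list \<Rightarrow> real" where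
  "tensor_of_poly m n f is =
     (if is \<in> index_tuples m n
      then Poly_Mapping.lookup f (tuple_exponent is) /
           real (card {js \<in> index_tuples m n. tuple_exponent js = tuple_exponent is})
      else 0)"

text \<open>
  This is the dot product of the coefficient vectors in the unnormalized monomial basis, which
  differs from the entrywise (Frobenius) product of tensors.
\<close>

definition tensor_inner :: "nat \<Rightarrow> nat \<Rightarrow> (nat list \<Rightarrow> real) \<Rightarrow> (nat list \<Rightarrow> real) \<Rightarrow> real" where
  "tensor_inner m n A B = (\<Sum>\<alpha>\<in>multi_indices n m. tensor_coeff m n A \<alpha> * tensor_coeff m n B \<alpha>)"

definition SOS :: "nat \<Rightarrow> nat \<Rightarrow> (nat list \<Rightarrow> real) set" where
  "SOS m n =
     {A \<in> sym_tensors m n. \<exists>k N (q :: nat \<Rightarrow> mpoly). m = 2 * k \<and>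
        (\<forall>j<N. q j \<in> hom_polys n k) \<and> tensor_poly m n A = (\<Sum>j<N. (q j)\<^sup>2)}"

definition SOS_dual :: "nat \<Rightarrow> nat \<Rightarrow> (nat list \<Rightarrow> real) set" where
  "SOS_dual m n = {B \<in> sym_tensors m n. \<forall>A\<in>SOS m n. tensor_inner m n A B \<ge> 0}"


lemma finite_index_tuples: "finite (index_tuples m n)"
  unfolding index_tuples_def by (rule finite_lists_length_eq) simp

lemma lookup_tuple_exponent: "Poly_Mapping.lookup (tuple_exponent is) i = count (mset is) i"
  by (induction "is") (auto simp: tuple_exponent_def lookup_add lookup_single when_def)

lemma tuple_exponent_eq_iff: "tuple_exponent is = tuple_exponent js \<longleftrightarrow> mset is = mset js"
  by (simp add: poly_mapping_eq_iff fun_eq_iff multiset_eq_iff lookup_tuple_exponent)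

lemma index_tuples_mset_cong: "mset is = mset js \<Longrightarrow> is \<in> index_tuples m n \<longleftrightarrow> js \<in> index_tuples m n"
  using mset_eq_setD[of "is" js] mset_eq_length[of "is" js] by (simp add: index_tuples_def)

lemma tuple_exponent_image: "tuple_exponent ` index_tuples m n = multi_indices n m"
proof (intro equalityI subsetI)
  fix \<alpha> assume "\<alpha> \<in> tuple_exponent ` index_tuples m n"
  then obtain "is" where i: "set is \<subseteq> {..<n}" "length is = m" and a: "\<alpha> = tuple_exponent is"
    by (auto simp: index_tuples_def)
  have "(\<Sum>i<n. count (mset is) i) = (\<Sum>i\<in>set is. count (mset is) i)"
    by (rule sum.mono_neutral_right) (use i in \<open>auto simp: count_eq_zero_iff\<close>)
  also have "\<dots> = m"
    using i(2) size_multiset_overloaded_eq[of "mset is"] by simp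
  finally have "(\<Sum>i<n. count (mset is) i) = m" .
  moreover have "Poly_Mapping.keys \<alpha> \<subseteq> {..<n}"
    using i(1) by (auto simp: a in_keys_iff lookup_tuple_exponent)
  ultimately show "\<alpha> \<in> multi_indices n m"
    by (simp add: multi_indices_def a lookup_tuple_exponent)
next
  fix \<alpha> assume \<alpha>: "\<alpha> \<in> multi_indices n m"
  define M where "M = Abs_multiset (Poly_Mapping.lookup \<alpha>)"
  have cM: "count M = Poly_Mapping.lookup \<alpha>"
    unfolding M_def by (rule Abs_multiset_inverse) (use finite_lookup[of \<alpha>] in simp)
  obtain "is" where i: "mset is = M" using ex_mset by blast
  have e: "tuple_exponent is = \<alpha>"
    by (simp add: poly_mapping_eq_iff fun_eq_iff lookup_tuple_exponent i cM)
  have s: "set is \<subseteq> {..<n}"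
  proof
    fix j assume "j \<in> set is"
    then have "count (mset is) j \<noteq> 0" by (simp add: count_eq_zero_iff)
    then have "j \<in> Poly_Mapping.keys \<alpha>" by (simp add: i cM in_keys_iff)
    then show "j \<in> {..<n}" using \<alpha> by (auto simp: multi_indices_def)
  qed
  have "length is = (\<Sum>i\<in>set is. count (mset is) i)"
    using size_multiset_overloaded_eq[of "mset is"] by simp
  also have "\<dots> = (\<Sum>i<n. count (mset is) i)"
    by (rule sum.mono_neutral_left) (use s in \<open>auto simp: count_eq_zero_iff\<close>)
  also have "\<dots> = m" using \<alpha> by (simp add: i cM multi_indices_def)
  finally show "\<alpha> \<in> tuple_exponent ` index_tuples m n"
    using s e by (auto simp: index_tuples_def)
qed

lemma finite_multi_indices: "finite (multi_indices n d)"
  by (simp flip: tuple_exponent_image add: finite_index_tuples)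

lemma tensor_coeff_eq:
  "tensor_coeff m n A \<alpha> = (\<Sum>is | is \<in> index_tuples m n \<and> tuple_exponent is = \<alpha>. A is)"
  unfolding tensor_coeff_def tensor_poly_def
  by (simp add: lookup_sum lookup_single when_def sum.inter_filter[OF finite_index_tuples])

lemma tensor_of_poly_in_sym_tensors: "tensor_of_poly m n f \<in> sym_tensors m n"
proof -
  have "tensor_of_poly m n f is = tensor_of_poly m n f js" if "mset is = mset js" for "is" js
    using that index_tuples_mset_cong[OF that] tuple_exponent_eq_iff[of "is" js]
    by (simp add: tensor_of_poly_def)
  moreover have "tensor_of_poly m n f is = 0" if "is \<notin> index_tuples m n" for "is"
    using that by (simp add: tensor_of_poly_def)
  ultimately show ?thesis unfolding sym_tensors_def by blast
qed

lemma tensor_poly_in_hom_polys: "tensor_poly m n A \<in> hom_polys n m"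
proof -
  have "\<alpha> \<in> multi_indices n m" if "tensor_coeff m n A \<alpha> \<noteq> 0" for \<alpha>
  proof -
    from that obtain "is" where "is \<in> index_tuples m n" "tuple_exponent is = \<alpha>"
      unfolding tensor_coeff_eq by (metis (mono_tags, lifting) mem_Collect_eq sum.neutral)
    then show ?thesis using tuple_exponent_image by blast
  qed
  then show ?thesis by (auto simp: hom_polys_def in_keys_iff tensor_coeff_def)
qed

lemma tensor_poly_of_poly:
  assumes "f \<in> hom_polys n m"
  shows "tensor_poly m n (tensor_of_poly m n f) = f"
proof (rule poly_mapping_eqI)
  fix \<alpha>
  let ?F = "{is \<in> index_tuples m n. tuple_exponent is = \<alpha>}"
  have fin: "finite ?F" using finite_index_tuples by simp
  have "tensor_coeff m n (tensor_of_poly m n f) \<alpha> = (\<Sum>is\<in>?F. Poly_Mapping.lookup f \<alpha> / real (card ?F))"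
    unfolding tensor_coeff_eq by (rule sum.cong) (auto simp: tensor_of_poly_def)
  also have "\<dots> = Poly_Mapping.lookup f \<alpha>"
  proof (cases "?F = {}")
    case True
    then have "\<alpha> \<notin> multi_indices n m" by (auto simp flip: tuple_exponent_image)
    then have "Poly_Mapping.lookup f \<alpha> = 0"
      using assms by (auto simp: hom_polys_def in_keys_iff subset_eq)
    then show ?thesis by simp
  next
    case False
    then have "card ?F \<noteq> 0" using fin by simp
    then show ?thesis by simp
  qed
  finally show "Poly_Mapping.lookup (tensor_poly m n (tensor_of_poly m n f)) \<alpha> = Poly_Mapping.lookup f \<alpha>"
    by (simp add: tensor_coeff_def)
qed

lemma tensor_of_tensor_poly:
  assumes "A \<in> sym_tensors m n"
  shows "tensor_of_poly m n (tensor_poly m n A) = A"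
proof
  fix "is"
  show "tensor_of_poly m n (tensor_poly m n A) is = A is"
  proof (cases "is \<in> index_tuples m n")
    case True
    let ?F = "{js \<in> index_tuples m n. tuple_exponent js = tuple_exponent is}"
    have "card ?F \<noteq> 0" using True finite_index_tuples by auto
    moreover have "tensor_coeff m n A (tuple_exponent is) = (\<Sum>js\<in>?F. A is)"
      unfolding tensor_coeff_eq
    proof (rule sum.cong)
      fix js assume "js \<in> ?F"
      then have "mset js = mset is" by (simp add: tuple_exponent_eq_iff)
      then show "A js = A is" using assms unfolding sym_tensors_def by blast
    qed simp
    ultimately show ?thesis using True by (simp add: tensor_of_poly_def tensor_coeff_def)
  next
    case False
    then show ?thesis using assms by (simp add: tensor_of_poly_def sym_tensors_def)
  qed
qed

lemma add_in_multi_indices: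
  assumes "\<beta> \<in> multi_indices n k" "\<gamma> \<in> multi_indices n l"
  shows "\<beta> + \<gamma> \<in> multi_indices n (k + l)"
  using assms keys_add[of \<beta> \<gamma>] unfolding multi_indices_def
  by (auto simp: lookup_add sum.distrib)

lemma power2_in_hom_polys:
  assumes "p \<in> hom_polys n k"
  shows "p\<^sup>2 \<in> hom_polys n (2 * k)"
  using assms keys_mult[of p p] add_in_multi_indices[of _ n k _ k]
  unfolding hom_polys_def power2_eq_square mult_2 by blast

lemma tensor_coeff_square:
  assumes "p \<in> hom_polys n k"
  shows "tensor_coeff (2 * k) n (tensor_of_poly (2 * k) n (p\<^sup>2)) \<alpha> =
    (\<Sum>(\<beta>, \<gamma>) | \<beta> \<in> multi_indices n k \<and> \<gamma> \<in> multi_indices n k \<and> \<beta> + \<gamma> = \<alpha>.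
       Poly_Mapping.lookup p \<beta> * Poly_Mapping.lookup p \<gamma>)"
proof -
  let ?c = "Poly_Mapping.lookup p" and ?I = "multi_indices n k"
  have keys: "\<beta> \<in> ?I" if "?c \<beta> \<noteq> 0" for \<beta>
    using that assms by (auto simp: hom_polys_def in_keys_iff)
  have "tensor_coeff (2 * k) n (tensor_of_poly (2 * k) n (p\<^sup>2)) \<alpha> = Poly_Mapping.lookup (p * p) \<alpha>"
    unfolding tensor_coeff_def tensor_poly_of_poly[OF power2_in_hom_polys[OF assms]]
    by (simp add: power2_eq_square)
  also have "\<dots> = (\<Sum>(\<beta>, \<gamma>). ?c \<beta> * ?c \<gamma> when \<alpha> = \<beta> + \<gamma>)"
    by (simp add: times_poly_mapping.rep_eq prod_fun_unfold_prod)
  also have "\<dots> = (\<Sum>(\<beta>, \<gamma>)\<in>?I \<times> ?I. ?c \<beta> * ?c \<gamma> when \<alpha> = \<beta> + \<gamma>)"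
    by (rule Sum_any.expand_superset) (auto simp: finite_multi_indices intro: keys)
  also have "\<dots> = (\<Sum>(\<beta>, \<gamma>) | \<beta> \<in> ?I \<and> \<gamma> \<in> ?I \<and> \<beta> + \<gamma> = \<alpha>. ?c \<beta> * ?c \<gamma>)"
    by (rule sum.mono_neutral_cong_right) (auto simp: finite_multi_indices when_def split: if_splits)
  finally show ?thesis .
qed

end

theory Submission
  imports Defs
begin

text \<open>
  Pairing with \<open>B\<close> is a linear functional of the associated polynomial of the other argument:
  the inner product only sees a tensor through the coefficients of its polynomial. A linear
  functional is nonnegative on the cone of sums of squares exactly when it is nonnegative on
  single squares, which generate this cone. Each square \<open>p\<^sup>2\<close> is itself the polynomial of a tensor
  in the cone, which gives one direction; for the other, the pairing distributes over
  \<open>\<Sum>\<^sub>j q\<^sub>j\<^sup>2\<close> (\<open>tensor_inner_sum_poly\<close>).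
\<close>

lemma tensor_of_square_in_SOS:
  assumes "p \<in> hom_polys n k"
  shows "tensor_of_poly (2 * k) n (p\<^sup>2) \<in> SOS (2 * k) n"
proof -
  have "tensor_poly (2 * k) n (tensor_of_poly (2 * k) n (p\<^sup>2)) = (\<Sum>j<Suc 0. p\<^sup>2)"
    by (simp add: tensor_poly_of_poly[OF power2_in_hom_polys[OF assms]])
  then show ?thesis
    using assms tensor_of_poly_in_sym_tensors unfolding SOS_def
    by (intro CollectI conjI exI[of _ k] exI[of _ "Suc 0"] exI[of _ "\<lambda>_. p"]) auto
qed

text \<open>
  The decomposition is required only of the polynomial of \<open>A\<close>, so that a sum-of-squares
  representation can be used without transporting it to an identity between tensors.
\<close>

lemma tensor_inner_sum_poly:
  assumes "tensor_poly m n A = (\<Sum>j\<in>J. f j)"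
    and "\<And>j. j \<in> J \<Longrightarrow> f j \<in> hom_polys n m"
  shows "tensor_inner m n A B = (\<Sum>j\<in>J. tensor_inner m n (tensor_of_poly m n (f j)) B)"
proof -
  have "tensor_coeff m n A \<alpha> = (\<Sum>j\<in>J. tensor_coeff m n (tensor_of_poly m n (f j)) \<alpha>)" for \<alpha>
    using assms by (simp add: tensor_coeff_def tensor_poly_of_poly lookup_sum)
  then show ?thesis
    unfolding tensor_inner_def by (simp add: sum_distrib_right sum.swap[of _ J])
qed

theorem proposition6p2:
  fixes m n k :: nat and B :: "nat list \<Rightarrow> real"
  assumes "m \<ge> 2" and "n \<ge> 2" and "m = 2 * k"
    and "B \<in> sym_tensors m n"
  shows "B \<in> SOS_dual m n \<longleftrightarrow>
    (\<forall>p\<in>hom_polys n k. tensor_inner m n (tensor_of_poly m n (p\<^sup>2)) B \<ge> 0)"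
proof
  assume "B \<in> SOS_dual m n"
  then show "\<forall>p\<in>hom_polys n k. tensor_inner m n (tensor_of_poly m n (p\<^sup>2)) B \<ge> 0"
    using tensor_of_square_in_SOS \<open>m = 2 * k\<close> by (auto simp: SOS_dual_def)
next
  assume squares: "\<forall>p\<in>hom_polys n k. tensor_inner m n (tensor_of_poly m n (p\<^sup>2)) B \<ge> 0"
  have "tensor_inner m n A B \<ge> 0" if "A \<in> SOS m n" for A
  proof -
    from that \<open>m = 2 * k\<close> obtain N and q :: "nat \<Rightarrow> mpoly"
      where q: "\<And>j. j < N \<Longrightarrow> q j \<in> hom_polys n k"
        and A: "tensor_poly m n A = (\<Sum>j<N. (q j)\<^sup>2)"
      unfolding SOS_def by auto
    have "tensor_inner m n A B = (\<Sum>j<N. tensor_inner m n (tensor_of_poly m n ((q j)\<^sup>2)) B)"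
      using A by (rule tensor_inner_sum_poly) (use q power2_in_hom_polys \<open>m = 2 * k\<close> in auto)
    also have "\<dots> \<ge> 0"
      using squares q by (intro sum_nonneg) auto
    finally show ?thesis .
  qed
  then show "B \<in> SOS_dual m n"
    using \<open>B \<in> sym_tensors m n\<close> by (simp add: SOS_dual_def)
qed

end
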